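(* Let $g\colon U\to V$ be a morphism of associative algebras over a field of characteristic $0$ and $T=U\oplus V$. Let $k\ge3$, let $\theta_s\in C^{n_s-1}_{\mathbf{As}_{B\to W}}(T;T)$ for $1\le s\le k$, correspond to $(\theta_{s,U},\theta_{s,V},\theta_{s,g})\in C^{n_s}_{GS}(g;g)$, and put $t=3-2k+\sum_{s=1}^kn_s$, so that $l_k(\theta_1,\ldots,\theta_k)\in C^{t-1}_{\mathbf{As}_{B\to W}}(T;T)$. Then $$l_k(\theta_1,\ldots,\theta_k)(\mu_t)=0,\qquad l_k(\theta_1,\ldots,\theta_k)(\nu_t)=0,$$ and $$l_k(\theta_1,\ldots,\theta_k)(f_{t-1})=-(-1)^{\nu(\theta_1,\ldots,\theta_k)}\sum_{s=1}^k\sum_{\mathbf a}(-1)^{\mathbf a}\,\theta_{s,V}\circ_{\mathbf a}(\theta_{1,g},\ldots,\widehat{\theta_{s,g}},\ldots,\theta_{k,g}),$$ where, for each $s$, $\mathbf a=(a_1,\ldots,\widehat{a_s},\ldots,a_k)$ runs through all $(k-1)$-tuples of distinct points of $\{1,\ldots,n_s\}$.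
   Context: $\mathbf k$ is a field of characteristic $0$; $(U,\mu_U)$, $(V,\mu_V)$ are associative $\mathbf k$-algebras and $g\colon U\to V$ an algebra morphism. $T=U\oplus V$ is two-colored with $T_B=U$, $T_W=V$; $\mathrm{End}_T$ is its 2-colored endomorphism PROP (multilinear maps between tensor products of $U$'s and $V$'s). **Minimal model.** $\mathbf{As}_{B\to W}$ is the 2-colored operad whose algebras are morphisms of associative algebras. Its minimal model is $(\mathsf F(E),\partial)$, the free 2-colored PROP on the 2-colored $\Sigma$-bimodule $E$ freely generated by $\mu_n\colon B^{\otimes n}\to B$ of degree $n-2$ ($n\ge2$), $\nu_n\colon W^{\otimes n}\to W$ of degree $n-2$ ($n\ge2$), $f_n\colon B^{\otimes n}\to W$ of degree $n-1$ ($n\ge1$), with $$\partial(\mu_n)=\sum_{\substack{i+j=n+1\\ i,j\ge2}}\sum_{s=0}^{n-j}(-1)^{i+s(j+1)}\mu_i\circ_{s+1}\mu_j,\qquad \partial(\nu_n)=\sum_{\substack{i+j=n+1\\ i,j\ge2}}\sum_{s=0}^{n-j}(-1)^{i+s(j+1)}\nu_i\circ_{s+1}\nu_j,$$ $$\partial(f_n)=-\sum_{l=2}^n\sum_{r_1+\cdots+r_l=n}(-1)^{\sum_{1\le i<j\le l}r_i(r_j+1)}\nu_l(f_{r_1}\otimes\cdots\otimes f_{r_l})-\sum_{\substack{i+j=n+1\\ i\ge1,j\ge2}}\sum_{s=0}^{n-j}(-1)^{i+s(j+1)}f_i\circ_{s+1}\mu_j,$$ where $x\circ_{s+1}y$ plugs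 $y$ into the $(s+1)$st input of $x$. The morphism $g$ corresponds to $\beta\colon\mathsf F(E)\to\mathrm{End}_T$ with $\beta(\mu_2)=\mu_U$, $\beta(\nu_2)=\mu_V$, $\beta(f_1)=g$, and $\beta=0$ on all other generators $\mu_n,\nu_n,f_n$. **Deformation complex.** $C^*_{\mathbf{As}_{B\to W}}(T;T)\cong\,\uparrow\mathrm{Hom}_\Sigma(E,\mathrm{End}_T)^{-*}$ ($\uparrow$ suspension, $-*$ reversed grading): an element $\theta\in C^{p}$ ($p\ge1$), of degree $|\theta|=p$, is a color-preserving equivariant linear map $E\to\mathrm{End}_T$ supported on generators of degree $p-1$. It is identified with $(\theta_U,\theta_V,\theta_g):=(\theta(\mu_{p+1}),\theta(\nu_{p+1}),\theta(f_p))\in C^{p+1}_{GS}(g;g)$, where $C^n_{GS}(g;g)=\mathrm{Hom}(U^{\otimes n},U)\oplus\mathrm{Hom}(V^{\otimes n},V)\oplus\mathrm{Hom}(U^{\otimes n-1},V)$. In the claim all $n_s\ge2$, and $(\theta_{s,U},\theta_{s,V},\theta_{s,g})=(\theta_s(\mu_{n_s}),\theta_s(\nu_{n_s}),\theta_s(f_{n_s-1}))$. **Operations $l_k$.** For cochains $F_1,\ldots,F_k$ and a generator $\xi$, write $\partial(\xi)=\sum_s\Gamma_s$ as a sum of $E$-decorated graphs (as displayed). Then $$l_k(F_1,\ldots,F_k)(\xi)=(-1)^{\nu(F_1,\ldots,F_k)}\sum_s\sum_{(v_1,\ldots,v_k)}\gamma\big(\Gamma_s^{\{v_1,\ldots,v_k\}}[F_1,\ldots,F_k]\big),\qquad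 \nu(F_1,\ldots,F_k)=(k-1)|F_1|+(k-2)|F_2|+\cdots+|F_{k-1}|,$$ where $(v_1,\ldots,v_k)$ runs over all $k$-tuples of distinct vertices of $\Gamma_s$, the graph $\Gamma_s^{\{v_1,\ldots,v_k\}}[F_1,\ldots,F_k]$ is obtained by replacing the decoration $e_{v_i}$ of $v_i$ by $F_i(e_{v_i})$ and every other decoration $e_v$ by $\beta(e_v)$, and $\gamma$ is the resulting composite in $\mathrm{End}_T$. The only signs are the displayed ones and the coefficients in $\partial(\xi)$. **Generalized comp operation.** A hat denotes omission. For fixed $s$ and a $(k-1)$-tuple $\mathbf a=(a_1,\ldots,\widehat{a_s},\ldots,a_k)$ of distinct points of $\{1,\ldots,n_s\}$, $\theta_{s,V}\circ_{\mathbf a}(\theta_{1,g},\ldots,\widehat{\theta_{s,g}},\ldots,\theta_{k,g})\in\mathrm{Hom}(U^{\otimes t-1},V)$ is obtained by plugging $\theta_{j,g}$ ($j\ne s$) into the $a_j$-th input of $\theta_{s,V}$ and $g$ into the other $n_s-(k-1)$ inputs. The sign is $(-1)^{\mathbf a}=(-1)^{\sum_{1\le i<j\le n_s}r_i(r_j+1)}$, where $r_a=|\theta_j|=n_j-1$ if $a=a_j$ for some $j\neq s$, and $r_a=1$ otherwise. *)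

theory Defs
  imports "HOL-Analysis.Product_Vector" "HOL-Library.FuncSet" "HOL-Library.Poly_Mapping"
begin

section \<open>Associative algebras and their morphisms\<close>

text \<open>Algebras are not assumed unital: the class \<^class>\<open>ring\<close> has no unit.\<close>

locale assoc_algebra = vector_space scale
  for scale :: "'k::field \<Rightarrow> 'a::ring \<Rightarrow> 'a" +
  assumes scale_mult_left: "scale c (x * y) = scale c x * y"
    and scale_mult_right: "scale c (x * y) = x * scale c y"

locale assoc_algebra_hom =
  dom: assoc_algebra sU + cod: assoc_algebra sV + Vector_Spaces.linear sU sV g
  for sU :: "'k::field \<Rightarrow> 'u::ring \<Rightarrow> 'u" and sV :: "'k \<Rightarrow> 'v::ring \<Rightarrow> 'v" and g :: "'u \<Rightarrow> 'v" +
  assumes hom_mult: "g (x * y) = g x * g y"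


section \<open>The generators of the minimal model\<close>

datatype colour = Black | White

datatype gen = Mu nat | Nu nat | F nat

text \<open>
  The terms \<open>Mu 0\<close>, \<open>Mu 1\<close>, \<open>Nu 0\<close>, \<open>Nu 1\<close> and \<open>F 0\<close> do not denote generators.
\<close>

fun is_gen :: "gen \<Rightarrow> bool" where
  "is_gen (Mu n) \<longleftrightarrow> n \<ge> 2"
| "is_gen (Nu n) \<longleftrightarrow> n \<ge> 2"
| "is_gen (F n) \<longleftrightarrow> n \<ge> 1"

fun arity :: "gen \<Rightarrow> nat" where
  "arity (Mu n) = n"
| "arity (Nu n) = n"
| "arity (F n) = n"

fun in_col :: "gen \<Rightarrow> colour" where
  "in_col (Mu n) = Black"
| "in_col (Nu n) = White"
| "in_col (F n) = Black"

fun out_col :: "gen \<Rightarrow> colour" where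
  "out_col (Mu n) = Black"
| "out_col (Nu n) = White"
| "out_col (F n) = White"

fun degree :: "gen \<Rightarrow> nat" where
  "degree (Mu n) = n - 2"
| "degree (Nu n) = n - 2"
| "degree (F n) = n - 1"


section \<open>Decorated graphs\<close>

text \<open>
  Every generator has exactly one output, and in the differential of a generator the inputs of
  each graph occur in their planar order. Hence the graphs which occur are planar rooted trees
  whose leaves, read from left to right, are the inputs \<open>1, 2, \<dots>\<close> of the graph.
  A vertex is addressed by the path of child indices leading to it from the root.
\<close>

datatype 'd tree = Leaf | Vertex 'd "'d tree list"

primrec leaves :: "'d tree \<Rightarrow> nat" where
  "leaves Leaf = 1"
| "leaves (Vertex d ts) = sum_list (map leaves ts)"

primrec vertices :: "'d tree \<Rightarrow> nat list set" where
  "vertices Leaf = {}"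
| "vertices (Vertex d ts) = insert [] (\<Union>i<length ts. (#) i ` (map vertices ts ! i))"

text \<open>\<open>redecorate \<Gamma> h\<close> replaces the decoration \<open>d\<close> of each vertex \<open>p\<close> of \<open>\<Gamma>\<close> by \<open>h p d\<close>.\<close>

primrec redecorate :: "'d tree \<Rightarrow> (nat list \<Rightarrow> 'd \<Rightarrow> 'e) \<Rightarrow> 'e tree" where
  "redecorate Leaf = (\<lambda>h. Leaf)"
| "redecorate (Vertex d ts) =
     (\<lambda>h. Vertex (h [] d)
            (map2 (\<lambda>i r. r (\<lambda>p. h (i # p))) [0..<length ts] (map redecorate ts)))"

definition corolla :: "gen \<Rightarrow> gen tree" where
  "corolla e = Vertex e (replicate (arity e) Leaf)"

text \<open>\<open>graft x s y\<close> is \<open>x \<circ>\<^bsub>s+1\<^esub> y\<close>; list positions start at \<open>0\<close>.\<close>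

definition graft :: "gen \<Rightarrow> nat \<Rightarrow> gen \<Rightarrow> gen tree" where
  "graft x s y = Vertex x ((replicate (arity x) Leaf)[s := corolla y])"


section \<open>The differential on generators\<close>

text \<open>
  The exponent \<open>\<Sum>\<^bsub>1\<le>i<j\<le>l\<^esub> r\<^sub>i (r\<^sub>j + 1)\<close> of a list \<open>[r\<^sub>1, \<dots>, r\<^sub>l]\<close>; list positions start at \<open>0\<close>.
\<close>

definition sign_exp :: "nat list \<Rightarrow> nat" where
  "sign_exp rs = (\<Sum>(i, j)\<in>{(i, j). i < j \<and> j < length rs}. rs ! i * (rs ! j + 1))"

text \<open>Formal linear combinations of trees are finitely supported functions.\<close>

fun bdry :: "gen \<Rightarrow> (gen tree \<Rightarrow>\<^sub>0 'k::field)" where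
  "bdry (Mu n) =
     (\<Sum>(i, j)\<in>{(i, j). i + j = n + 1 \<and> i \<ge> 2 \<and> j \<ge> 2}. \<Sum>s=0..n - j.
        Poly_Mapping.single (graft (Mu i) s (Mu j)) ((-1) ^ (i + s * (j + 1))))"
| "bdry (Nu n) =
     (\<Sum>(i, j)\<in>{(i, j). i + j = n + 1 \<and> i \<ge> 2 \<and> j \<ge> 2}. \<Sum>s=0..n - j.
        Poly_Mapping.single (graft (Nu i) s (Nu j)) ((-1) ^ (i + s * (j + 1))))"
| "bdry (F n) =
     - (\<Sum>l=2..n. \<Sum>rs\<in>{rs. length rs = l \<and> sum_list rs = n \<and> (\<forall>r\<in>set rs. r \<ge> 1)}.
          Poly_Mapping.single (Vertex (Nu l) (map (\<lambda>r. corolla (F r)) rs)) ((-1) ^ sign_exp rs))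
     - (\<Sum>(i, j)\<in>{(i, j). i + j = n + 1 \<and> i \<ge> 1 \<and> j \<ge> 2}. \<Sum>s=0..n - j.
          Poly_Mapping.single (graft (F i) s (Mu j)) ((-1) ^ (i + s * (j + 1))))"


section \<open>The endomorphism PROP of \<open>T = U \<oplus> V\<close>\<close>

text \<open>
  A map \<open>T\<^sub>c \<otimes> \<dots> \<otimes> T\<^sub>c \<rightarrow> T\<^sub>d\<close> with \<open>n\<close> factors is a multilinear function on lists of length \<open>n\<close> with
  entries in \<open>T\<^sub>c \<subseteq> T\<close>, extended by \<open>0\<close> to all other lists, so that equality of functions is
  equality of such maps. Only these components of the PROP are needed, because all inputs of
  a generator have the same colour.
\<close>

abbreviation scaleT ::
  "('k::field \<Rightarrow> 'u::ab_group_add \<Rightarrow> 'u) \<Rightarrow> ('k \<Rightarrow> 'v::ab_group_add \<Rightarrow> 'v) \<Rightarrow> 'k \<Rightarrow> 'u \<times> 'v \<Rightarrow> 'u \<times> 'v"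
  where "scaleT sU sV \<equiv> module_prod.scale sU sV"

definition inU :: "'u \<Rightarrow> 'u \<times> 'v::zero" where
  "inU u = (u, 0)"

definition inV :: "'v \<Rightarrow> 'u::zero \<times> 'v" where
  "inV v = (0, v)"

fun part :: "colour \<Rightarrow> ('u::zero \<times> 'v::zero) set" where
  "part Black = range inU"
| "part White = range inV"

definition extend0 :: "'t set \<Rightarrow> nat \<Rightarrow> ('t list \<Rightarrow> 't) \<Rightarrow> 't list \<Rightarrow> 't::zero" where
  "extend0 A n \<phi> xs = (if length xs = n \<and> set xs \<subseteq> A then \<phi> xs else 0)"

definition multilinear_maps ::
  "('k \<Rightarrow> 't \<Rightarrow> 't) \<Rightarrow> 't set \<Rightarrow> nat \<Rightarrow> 't set \<Rightarrow> ('t list \<Rightarrow> 't::ab_group_add) set" where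
  "multilinear_maps sc A n B =
     {\<phi>. (\<forall>xs. \<phi> xs \<in> B) \<and> extend0 A n \<phi> = \<phi> \<and>
         (\<forall>xs i x y c. length xs = n \<and> set xs \<subseteq> A \<and> i < n \<and> x \<in> A \<and> y \<in> A \<longrightarrow>
            \<phi> (xs[i := x + y]) = \<phi> (xs[i := x]) + \<phi> (xs[i := y]) \<and>
            \<phi> (xs[i := sc c x]) = sc c (\<phi> (xs[i := x])))}"

text \<open>
  \<open>tensor [(m\<^sub>1, \<psi>\<^sub>1), \<dots>, (m\<^sub>l, \<psi>\<^sub>l)]\<close> is \<open>\<psi>\<^sub>1 \<otimes> \<dots> \<otimes> \<psi>\<^sub>l\<close>, where \<open>m\<^sub>i\<close> is the number of inputs of \<open>\<psi>\<^sub>i\<close>.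
\<close>

fun tensor :: "(nat \<times> ('a list \<Rightarrow> 'b)) list \<Rightarrow> 'a list \<Rightarrow> 'b list" where
  "tensor [] xs = []"
| "tensor ((m, \<psi>) # \<psi>s) xs = \<psi> (take m xs) # tensor \<psi>s (drop m xs)"

text \<open>The composite \<open>\<gamma>\<close> of a tree decorated by operations.\<close>

primrec composite :: "('t list \<Rightarrow> 't) tree \<Rightarrow> 't list \<Rightarrow> 't" where
  "composite Leaf = hd"
| "composite (Vertex \<phi> ts) = (\<lambda>xs. \<phi> (tensor (zip (map leaves ts) (map composite ts)) xs))"

fun beta :: "('u::ring \<Rightarrow> 'v::ring) \<Rightarrow> gen \<Rightarrow> ('u \<times> 'v) list \<Rightarrow> 'u \<times> 'v" where
  "beta g (Mu n) =
     (if n = 2 then extend0 (part Black) 2 (\<lambda>xs. inU (fst (xs ! 0) * fst (xs ! 1))) else (\<lambda>_. 0))"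
| "beta g (Nu n) =
     (if n = 2 then extend0 (part White) 2 (\<lambda>xs. inV (snd (xs ! 0) * snd (xs ! 1))) else (\<lambda>_. 0))"
| "beta g (F n) =
     (if n = 1 then extend0 (part Black) 1 (\<lambda>xs. inV (g (fst (xs ! 0)))) else (\<lambda>_. 0))"


section \<open>The deformation complex\<close>

text \<open>
  Since \<open>E\<close> is the \<open>\<Sigma>\<close>-bimodule freely generated by the generators, an equivariant linear map
  on \<open>E\<close> is the family of its values on the generators, and each of these values is an arbitrary
  element of the component of the endomorphism PROP with the colours of the generator.
  \<open>cochains sU sV p\<close> consists of the cochains of degree \<open>p\<close>.
\<close>

definition cochains ::
  "('k::field \<Rightarrow> 'u::ab_group_add \<Rightarrow> 'u) \<Rightarrow> ('k \<Rightarrow> 'v::ab_group_add \<Rightarrow> 'v) \<Rightarrow> nat \<Rightarrow>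
   (gen \<Rightarrow> ('u \<times> 'v) list \<Rightarrow> 'u \<times> 'v) set" where
  "cochains sU sV p =
     {\<theta>. \<forall>\<xi>. \<theta> \<xi> \<in> multilinear_maps (scaleT sU sV) (part (in_col \<xi>)) (arity \<xi>) (part (out_col \<xi>)) \<and>
              (\<not> (is_gen \<xi> \<and> degree \<xi> + 1 = p) \<longrightarrow> \<theta> \<xi> = (\<lambda>_. 0))}"

text \<open>
  The components \<open>\<theta>\<^sub>V\<close> and \<open>\<theta>\<^sub>g\<close> of a cochain \<open>\<theta>\<close> of degree \<open>n - 1\<close>, as functions on lists over \<open>V\<close>
  respectively \<open>U\<close>.
\<close>

definition compV ::
  "nat \<Rightarrow> (gen \<Rightarrow> ('u::zero \<times> 'v::zero) list \<Rightarrow> 'u \<times> 'v) \<Rightarrow> 'v list \<Rightarrow> 'v" where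
  "compV n \<theta> vs = snd (\<theta> (Nu n) (map inV vs))"

definition compg ::
  "nat \<Rightarrow> (gen \<Rightarrow> ('u::zero \<times> 'v::zero) list \<Rightarrow> 'u \<times> 'v) \<Rightarrow> 'u list \<Rightarrow> 'v" where
  "compg n \<theta> us = snd (\<theta> (F (n - 1)) (map inU us))"


section \<open>The operations \<open>l\<^sub>k\<close>\<close>

text \<open>Families \<open>F\<^sub>1, \<dots>, F\<^sub>k\<close> are functions on \<open>{1..k}\<close>; \<open>p i\<close> is the degree of \<open>F\<^sub>i\<close>.\<close>

definition nu_exp :: "nat \<Rightarrow> (nat \<Rightarrow> nat) \<Rightarrow> nat" where
  "nu_exp k p = (\<Sum>i=1..k. (k - i) * p i)"

definition injective_tuples :: "nat set \<Rightarrow> 'b set \<Rightarrow> (nat \<Rightarrow> 'b) set" where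
  "injective_tuples J S = {v \<in> J \<rightarrow>\<^sub>E S. inj_on v J}"

text \<open>The graph \<open>\<Gamma>\<^bsup>{v\<^sub>1,\<dots>,v\<^sub>k}\<^esup>[F\<^sub>1, \<dots>, F\<^sub>k]\<close>.\<close>

definition insert_cochains ::
  "(gen \<Rightarrow> 'o) \<Rightarrow> nat \<Rightarrow> (nat \<Rightarrow> gen \<Rightarrow> 'o) \<Rightarrow> (nat \<Rightarrow> nat list) \<Rightarrow> gen tree \<Rightarrow> 'o tree" where
  "insert_cochains \<beta> k Fs v \<Gamma> =
     redecorate \<Gamma> (\<lambda>p e. if p \<in> v ` {1..k} then Fs (the_inv_into {1..k} v p) e else \<beta> e)"

definition l_op ::
  "('k::field \<Rightarrow> 'u::ring \<Rightarrow> 'u) \<Rightarrow> ('k \<Rightarrow> 'v::ring \<Rightarrow> 'v) \<Rightarrow> ('u \<Rightarrow> 'v) \<Rightarrow> nat \<Rightarrow> (nat \<Rightarrow> nat) \<Rightarrow>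
   (nat \<Rightarrow> gen \<Rightarrow> ('u \<times> 'v) list \<Rightarrow> 'u \<times> 'v) \<Rightarrow> gen \<Rightarrow> ('u \<times> 'v) list \<Rightarrow> 'u \<times> 'v" where
  "l_op sU sV g k p Fs \<xi> = extend0 (part (in_col \<xi>)) (arity \<xi>)
     (\<lambda>xs. scaleT sU sV ((-1) ^ nu_exp k p)
        (\<Sum>\<Gamma>\<in>Poly_Mapping.keys (bdry \<xi> :: gen tree \<Rightarrow>\<^sub>0 'k).
           scaleT sU sV (Poly_Mapping.lookup (bdry \<xi>) \<Gamma>)
             (\<Sum>v\<in>injective_tuples {1..k} (vertices \<Gamma>).
                composite (insert_cochains (beta g) k Fs v \<Gamma>) xs)))"


section \<open>The generalized comp operation\<close>

text \<open>
  \<open>slots g J n \<psi> N a\<close> lists what is plugged into the inputs \<open>1, \<dots>, N\<close>, together with the numbers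
  \<open>r\<^sub>1, \<dots>, r\<^sub>N\<close> of inputs used up: the map \<open>\<psi> j\<close> with \<open>n j - 1\<close> inputs at the position \<open>a j\<close> for
  \<open>j \<in> J\<close>, and \<open>g\<close> at all other positions.
\<close>

definition slots ::
  "('u \<Rightarrow> 'v) \<Rightarrow> nat set \<Rightarrow> (nat \<Rightarrow> nat) \<Rightarrow> (nat \<Rightarrow> 'u list \<Rightarrow> 'v) \<Rightarrow> nat \<Rightarrow> (nat \<Rightarrow> nat) \<Rightarrow>
   (nat \<times> ('u list \<Rightarrow> 'v)) list" where
  "slots g J n \<psi> N a =
     map (\<lambda>q. if q \<in> a ` J then (let j = the_inv_into J a q in (n j - 1, \<psi> j))
              else (1, \<lambda>us. g (hd us))) [1..<N + 1]"

definition gen_comp ::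
  "('u \<Rightarrow> 'v) \<Rightarrow> nat set \<Rightarrow> (nat \<Rightarrow> nat) \<Rightarrow> ('v list \<Rightarrow> 'v) \<Rightarrow> nat \<Rightarrow> (nat \<Rightarrow> nat) \<Rightarrow>
   (nat \<Rightarrow> 'u list \<Rightarrow> 'v) \<Rightarrow> 'u list \<Rightarrow> 'v" where
  "gen_comp g J n \<phi> N a \<psi> us = \<phi> (tensor (slots g J n \<psi> N a) us)"

definition comp_exp :: "nat set \<Rightarrow> (nat \<Rightarrow> nat) \<Rightarrow> nat \<Rightarrow> (nat \<Rightarrow> nat) \<Rightarrow> nat" where
  "comp_exp J n N a =
     sign_exp (map (\<lambda>q. if q \<in> a ` J then n (the_inv_into J a q) - 1 else 1) [1..<N + 1])"

end

theory Submission
  imports Defs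
begin

text \<open>
  For \<open>k \<ge> 3\<close>, the only trees in the differentials with room for \<open>k\<close> cochains are the
  \<open>\<nu>\<^sub>l(f\<^bsub>r\<^sub>1\<^esub> \<otimes> \<dots> \<otimes> f\<^bsub>r\<^sub>l\<^esub>)\<close> in \<open>\<partial>(f\<^sub>m)\<close>: all others have just two vertices. If no cochain
  sits at the root of such a tree, then \<open>l \<ge> k \<ge> 3\<close> and the root is decorated by \<open>\<beta>(\<nu>\<^sub>l) = 0\<close>.
  Otherwise some \<open>\<theta>\<^sub>s\<close> sits at the root, and for degree reasons a nonzero contribution requires
  \<open>l = n\<^sub>s\<close>, \<open>r\<^sub>i = n\<^sub>j - 1\<close> at the vertices occupied by \<open>\<theta>\<^sub>j\<close> and \<open>r\<^sub>i = 1\<close> at the remaining ones, where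
  \<open>\<beta>\<close> gives \<open>g\<close>. Hence the nonzero contributions correspond to the pairs \<open>(s, a)\<close>.
\<close>

section \<open>Linear extension to formal linear combinations\<close>

text \<open>\<open>l_op\<close> sums over the support of \<open>bdry \<xi>\<close>, where coinciding
  trees would be collected. Reading that sum as a linear extension lets it be evaluated term by term
  on the displayed formula.\<close>

definition lin_ext ::
  "('a::zero \<Rightarrow> 'b \<Rightarrow> 'b::comm_monoid_add) \<Rightarrow> ('c \<Rightarrow> 'b) \<Rightarrow> ('c \<Rightarrow>\<^sub>0 'a) \<Rightarrow> 'b" where
  "lin_ext sc f p = (\<Sum>x\<in>Poly_Mapping.keys p. sc (Poly_Mapping.lookup p x) (f x))"

context module
begin

text \<open>Outside the support the coefficient is 0. Enlarging the index set puts \<open>p\<close>,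
  \<open>q\<close> and \<open>p + q\<close> over a common one, which is how additivity
  follows.\<close>

lemma lin_ext_superset:
  assumes "finite S" "Poly_Mapping.keys p \<subseteq> S"
  shows "lin_ext scale f p = (\<Sum>x\<in>S. scale (Poly_Mapping.lookup p x) (f x))"
  unfolding lin_ext_def
  by (rule sum.mono_neutral_left) (use assms in \<open>auto simp: in_keys_iff\<close>)

lemma lin_ext_zero: "lin_ext scale f 0 = 0"
  by (simp add: lin_ext_def)

lemma lin_ext_single: "lin_ext scale f (Poly_Mapping.single x c) = scale c (f x)"
  by (subst lin_ext_superset[of "{x}"]) auto

lemma lin_ext_add: "lin_ext scale f (p + q) = lin_ext scale f p + lin_ext scale f q"
proof -
  let ?S = "Poly_Mapping.keys p \<union> Poly_Mapping.keys q"
  have "lin_ext scale f r = (\<Sum>x\<in>?S. scale (Poly_Mapping.lookup r x) (f x))"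
    if "r \<in> {p, q, p + q}" for r
    by (rule lin_ext_superset) (use that keys_add[of p q] in auto)
  then show ?thesis
    by (simp add: lookup_add scale_left_distrib sum.distrib)
qed

lemma lin_ext_uminus: "lin_ext scale f (- p) = - lin_ext scale f p"
  by (metis add.right_inverse add_eq_0_iff lin_ext_add lin_ext_zero)

lemma lin_ext_diff: "lin_ext scale f (p - q) = lin_ext scale f p - lin_ext scale f q"
  by (metis diff_conv_add_uminus lin_ext_add lin_ext_uminus)

lemma lin_ext_sum: "lin_ext scale f (\<Sum>i\<in>I. p i) = (\<Sum>i\<in>I. lin_ext scale f (p i))"
  by (induction I rule: infinite_finite_induct) (simp_all add: lin_ext_add lin_ext_zero)

end


section \<open>Multilinear maps and tensor products\<close>

lemma multilinear_maps_range: "\<phi> \<in> multilinear_maps sc A n B \<Longrightarrow> \<phi> xs \<in> B"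
  by (simp add: multilinear_maps_def)

lemma multilinear_maps_outside:
  assumes "\<phi> \<in> multilinear_maps sc A n B" "\<not> (length xs = n \<and> set xs \<subseteq> A)"
  shows "\<phi> xs = 0"
proof -
  have "\<phi> xs = extend0 A n \<phi> xs"
    using assms(1) by (simp add: multilinear_maps_def)
  then show ?thesis
    using assms(2) by (simp add: extend0_def)
qed

lemma zero_in_multilinear_maps:
  assumes "module sc" "0 \<in> B"
  shows "(\<lambda>_. 0) \<in> multilinear_maps sc A n B"
  using assms by (auto simp: multilinear_maps_def extend0_def fun_eq_iff module.scale_zero_right)

text \<open>As \<open>A\<close> is closed under the operations, updated lists stay where
  \<open>extend0 A n f\<close> agrees with \<open>f\<close>.\<close>

lemma (in module) extend0_in_multilinear_maps:
  assumes "subspace A" "0 \<in> B"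
    and range: "\<And>xs. length xs = n \<Longrightarrow> set xs \<subseteq> A \<Longrightarrow> f xs \<in> B"
    and add: "\<And>xs i x y. length xs = n \<Longrightarrow> set xs \<subseteq> A \<Longrightarrow> i < n \<Longrightarrow> x \<in> A \<Longrightarrow> y \<in> A \<Longrightarrow>
      f (xs[i := x + y]) = f (xs[i := x]) + f (xs[i := y])"
    and scale: "\<And>xs i x c. length xs = n \<Longrightarrow> set xs \<subseteq> A \<Longrightarrow> i < n \<Longrightarrow> x \<in> A \<Longrightarrow>
      f (xs[i := scale c x]) = scale c (f (xs[i := x]))"
  shows "extend0 A n f \<in> multilinear_maps scale A n B"
proof -
  have upd: "extend0 A n f (xs[i := z]) = f (xs[i := z])"
    if "length xs = n" "set xs \<subseteq> A" "z \<in> A" for xs i z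
    using that set_update_subset_insert[of xs i z] by (auto simp: extend0_def)
  have "extend0 A n (extend0 A n f) = extend0 A n f"
    by (auto simp: extend0_def fun_eq_iff)
  moreover have "extend0 A n f xs \<in> B" for xs
    using assms(2) range by (simp add: extend0_def)
  ultimately show ?thesis
    using assms(1) by (auto simp: multilinear_maps_def upd add scale subspace_add subspace_scale)
qed

lemma (in module) multilinear_maps_add:
  assumes "\<phi> \<in> multilinear_maps scale A n B" "length xs = n" "set xs \<subseteq> A" "i < n" "x \<in> A" "y \<in> A"
  shows "\<phi> (xs[i := x + y]) = \<phi> (xs[i := x]) + \<phi> (xs[i := y])"
  using assms by (simp add: multilinear_maps_def)

lemma (in module) multilinear_maps_scale:
  assumes "\<phi> \<in> multilinear_maps scale A n B" "length xs = n" "set xs \<subseteq> A" "i < n" "x \<in> A"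
  shows "\<phi> (xs[i := scale c x]) = scale c (\<phi> (xs[i := x]))"
  using assms by (simp add: multilinear_maps_def)

lemma (in module) multilinear_maps_zero_entry:
  assumes \<phi>: "\<phi> \<in> multilinear_maps scale A n B" and "0 \<in> set xs"
  shows "\<phi> xs = 0"
proof (cases "length xs = n \<and> set xs \<subseteq> A")
  case True
  obtain i where i: "i < length xs" "xs ! i = 0"
    using assms(2) by (auto simp: in_set_conv_nth)
  \<comment> \<open>The entry is 0, so \<open>scale 0\<close> of it changes nothing in the list,
    while homogeneity turns the value into 0.\<close>
  have "\<phi> (xs[i := scale 0 (xs ! i)]) = scale 0 (\<phi> (xs[i := xs ! i]))"
    by (rule multilinear_maps_scale[OF \<phi>]) (use True i(1) in auto)
  then show ?thesis
    using i(2) by (metis list_update_id scale_zero_left)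
next
  case False
  then show ?thesis
    using multilinear_maps_outside[OF \<phi>] by blast
qed

lemma (in module) multilinear_maps_sum:
  assumes "subspace A" "subspace B" and \<phi>: "\<And>i. i \<in> I \<Longrightarrow> \<phi> i \<in> multilinear_maps scale A n B"
  shows "(\<lambda>xs. \<Sum>i\<in>I. \<phi> i xs) \<in> multilinear_maps scale A n B"
proof -
  \<comment> \<open>Each summand already vanishes off its domain, so extending the sum by 0 does not
    alter it.\<close>
  have "(\<lambda>xs. \<Sum>i\<in>I. \<phi> i xs) = extend0 A n (\<lambda>xs. \<Sum>i\<in>I. \<phi> i xs)"
    using multilinear_maps_outside[OF \<phi>] by (auto simp: extend0_def fun_eq_iff)
  also have "\<dots> \<in> multilinear_maps scale A n B"
    by (rule extend0_in_multilinear_maps)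
      (use assms multilinear_maps_range[OF \<phi>] in \<open>auto simp: subspace_0 sum.distrib scale_sum_right
        multilinear_maps_add[OF \<phi>] multilinear_maps_scale[OF \<phi>] intro!: subspace_sum\<close>)
  finally show ?thesis .
qed

lemma (in module) multilinear_maps_scaled:
  assumes "subspace A" "subspace B" and \<phi>: "\<phi> \<in> multilinear_maps scale A n B"
  shows "(\<lambda>xs. scale c (\<phi> xs)) \<in> multilinear_maps scale A n B"
proof -
  have "(\<lambda>xs. scale c (\<phi> xs)) = extend0 A n (\<lambda>xs. scale c (\<phi> xs))"
    using multilinear_maps_outside[OF \<phi>] by (auto simp: extend0_def fun_eq_iff)
  also have "\<dots> \<in> multilinear_maps scale A n B"
    by (rule extend0_in_multilinear_maps)
      (use assms multilinear_maps_range[OF \<phi>] in \<open>auto simp: subspace_0 subspace_scale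
        scale_right_distrib mult.commute multilinear_maps_add[OF \<phi>] multilinear_maps_scale[OF \<phi>]\<close>)
  finally show ?thesis .
qed

section \<open>Tensor products of maps\<close>

lemma length_tensor [simp]: "length (tensor \<psi>s xs) = length \<psi>s"
  by (induction \<psi>s xs rule: tensor.induct) auto

lemma set_tensor_subset:
  "(\<And>m \<psi> ys. (m, \<psi>) \<in> set \<psi>s \<Longrightarrow> \<psi> ys \<in> B) \<Longrightarrow> set (tensor \<psi>s xs) \<subseteq> B"
  by (induction \<psi>s xs rule: tensor.induct) auto

text \<open>The zero map yields 0 on whatever block it receives. Together with
  \<open>multilinear_maps_zero_entry\<close>, a zero child kills a whole composite.\<close>

lemma zero_in_tensor: "(m, \<lambda>_. 0) \<in> set \<psi>s \<Longrightarrow> 0 \<in> set (tensor \<psi>s xs)"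
  by (induction \<psi>s xs rule: tensor.induct) auto

text \<open>Naturality in the entries: it serves to pass between lists over \<open>T\<close> and
  lists over U or V, and with identities it gives \<open>tensor_cong\<close>. The length condition
  guarantees that each block has its full size.\<close>

lemma tensor_map:
  assumes "list_all2 (\<lambda>(m, \<psi>) (m', \<psi>'). m = m' \<and> (\<forall>ys. length ys = m \<longrightarrow> \<psi> (map f ys) = h (\<psi>' ys)))
      \<psi>s \<psi>s'"
    and "length xs = sum_list (map fst \<psi>s)"
  shows "tensor \<psi>s (map f xs) = map h (tensor \<psi>s' xs)"
  using assms
proof (induction arbitrary: xs rule: list_all2_induct)
  case (Cons p \<psi>s p' \<psi>s')
  then show ?case
    by (cases p; cases p') (auto simp: take_map drop_map)
qed simp

lemma tensor_cong:
  assumes "list_all2 (\<lambda>(m, \<psi>) (m', \<psi>'). m = m' \<and> (\<forall>ys. length ys = m \<longrightarrow> \<psi> ys = \<psi>' ys)) \<psi>s \<psi>s'"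
    and "length xs = sum_list (map fst \<psi>s)"
  shows "tensor \<psi>s xs = tensor \<psi>s' xs"
  using tensor_map[of "\<lambda>x. x" "\<lambda>x. x" \<psi>s \<psi>s' xs] assms by simp

text \<open>Entry \<open>i\<close> belongs to exactly one block: \<open>b\<close> is its number,
  \<open>ys\<close> the block itself and \<open>i'\<close> the place within it. None of them depends
  on \<open>z\<close>, so the values at \<open>x\<close>, \<open>y\<close> and \<open>x + y\<close>
  can be compared.\<close>

lemma tensor_update:
  assumes "length xs = sum_list (map fst \<psi>s)" "i < length xs"
  obtains b i' ys where "b < length \<psi>s" "i' < fst (\<psi>s ! b)" "length ys = fst (\<psi>s ! b)"
    "set ys \<subseteq> set xs" "\<And>z. tensor \<psi>s (xs[i := z]) = (tensor \<psi>s xs)[b := snd (\<psi>s ! b) (ys[i' := z])]"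
proof -
  have "\<exists>b i' ys. b < length \<psi>s \<and> i' < fst (\<psi>s ! b) \<and> length ys = fst (\<psi>s ! b) \<and> set ys \<subseteq> set xs \<and>
      (\<forall>z. tensor \<psi>s (xs[i := z]) = (tensor \<psi>s xs)[b := snd (\<psi>s ! b) (ys[i' := z])])"
    using assms
  proof (induction \<psi>s arbitrary: xs i)
    case Nil
    then show ?case by simp
  next
    case (Cons p \<psi>s)
    obtain m \<psi> where p: "p = (m, \<psi>)" by fastforce
    show ?case
    proof (cases "i < m")
      case True
      then show ?thesis
        using Cons.prems set_take_subset[of m xs]
        by (intro exI[of _ 0] exI[of _ i] exI[of _ "take m xs"]) (auto simp: p take_update_swap)
    next
      case False
      with Cons.prems obtain b i' ys where IH: "b < length \<psi>s" "i' < fst (\<psi>s ! b)"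
          "length ys = fst (\<psi>s ! b)" "set ys \<subseteq> set (drop m xs)"
          "\<And>z. tensor \<psi>s ((drop m xs)[i - m := z]) =
            (tensor \<psi>s (drop m xs))[b := snd (\<psi>s ! b) (ys[i' := z])]"
        using Cons.IH[of "drop m xs" "i - m"] by (auto simp: p less_diff_conv2)
      then show ?thesis
        using False set_drop_subset[of m xs]
        by (intro exI[of _ "Suc b"] exI[of _ i'] exI[of _ ys]) (auto simp: p drop_update_swap)
    qed
  qed
  then show thesis
    using that by blast
qed

text \<open>Changing one input changes a single block, so linearity passes first through the map on
  that block and then through the corresponding argument of \<open>\<phi>\<close>.\<close>

lemma (in module) multilinear_compose_tensor:
  assumes "subspace A" "0 \<in> C"
    and \<phi>: "\<phi> \<in> multilinear_maps scale B (length \<psi>s) C"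
    and \<psi>s: "\<And>m \<psi>. (m, \<psi>) \<in> set \<psi>s \<Longrightarrow> \<psi> \<in> multilinear_maps scale A m B"
    and n: "n = sum_list (map fst \<psi>s)"
  shows "extend0 A n (\<lambda>xs. \<phi> (tensor \<psi>s xs)) \<in> multilinear_maps scale A n C"
proof (rule extend0_in_multilinear_maps)
  have B: "set (tensor \<psi>s xs) \<subseteq> B" for xs
    using set_tensor_subset \<psi>s multilinear_maps_range by metis
  have \<psi>: "snd (\<psi>s ! b) \<in> multilinear_maps scale A (fst (\<psi>s ! b)) B" if "b < length \<psi>s" for b
    using \<psi>s[of "fst (\<psi>s ! b)" "snd (\<psi>s ! b)"] that by simp
  fix xs i x y c
  assume xs: "length xs = n" "set xs \<subseteq> A" "i < n" "x \<in> A"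
  obtain b i' ys where b: "b < length \<psi>s" "i' < fst (\<psi>s ! b)" "length ys = fst (\<psi>s ! b)"
    "set ys \<subseteq> set xs" "\<And>z. tensor \<psi>s (xs[i := z]) = (tensor \<psi>s xs)[b := snd (\<psi>s ! b) (ys[i' := z])]"
    using tensor_update[of xs \<psi>s i] xs n by metis
  have ys: "set ys \<subseteq> A"
    using b(4) xs(2) by blast
  note \<psi>b = \<psi>[OF b(1)]
  show "\<phi> (tensor \<psi>s (xs[i := scale c x])) = scale c (\<phi> (tensor \<psi>s (xs[i := x])))"
    using b ys xs B
    by (simp add: multilinear_maps_scale[OF \<phi>] multilinear_maps_scale[OF \<psi>b]
        multilinear_maps_range[OF \<psi>b])
  show "\<phi> (tensor \<psi>s (xs[i := x + y])) = \<phi> (tensor \<psi>s (xs[i := x])) + \<phi> (tensor \<psi>s (xs[i := y]))"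
    if "y \<in> A"
    using b ys xs B that
    by (simp add: multilinear_maps_add[OF \<phi>] multilinear_maps_add[OF \<psi>b]
        multilinear_maps_range[OF \<psi>b])
qed (use assms multilinear_maps_range[OF \<phi>] in auto)


section \<open>Trees of height two\<close>

lemma leaves_redecorate [simp]: "leaves (redecorate \<Gamma> h) = leaves \<Gamma>"
proof (induction \<Gamma> arbitrary: h)
  case (Vertex d ts)
  then have "map leaves (map2 (\<lambda>i r. r (\<lambda>p. h (i # p))) [0..<length ts] (map redecorate ts)) =
      map leaves ts"
    by (intro nth_equalityI) auto
  then show ?case
    by simp
qed simp

lemma redecorate_corolla: "redecorate (corolla e) h = Vertex (h [] e) (replicate (arity e) Leaf)"
  by (auto simp: corolla_def intro!: nth_equalityI)

lemma leaves_corolla [simp]: "leaves (corolla e) = arity e"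
  by (simp add: corolla_def sum_list_replicate)

lemma tensor_replicate_hd: "length xs = m \<Longrightarrow> tensor (replicate m (Suc 0, hd)) xs = xs"
proof (induction m arbitrary: xs)
  case (Suc m)
  then show ?case
    by (cases xs) auto
qed simp

lemma composite_corolla:
  "length xs = arity e \<Longrightarrow> composite (redecorate (corolla e) h) xs = h [] e xs"
  by (simp add: redecorate_corolla zip_replicate tensor_replicate_hd)

text \<open>With the right total length every corolla receives exactly as many inputs as its arity,
  and there its composite is its decoration.\<close>

lemma composite_height_two:
  assumes "length xs = sum_list (map arity es)"
  shows "composite (redecorate (Vertex d (map corolla es)) h) xs =
    h [] d (tensor (map (\<lambda>i. (arity (es ! i), h [i] (es ! i))) [0..<length es]) xs)"
proof -
  let ?ts = "map2 (\<lambda>i r. r (\<lambda>p. h (i # p))) [0..<length es] (map redecorate (map corolla es))"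
  have "tensor (zip (map leaves ?ts) (map composite ?ts)) xs =
      tensor (map (\<lambda>i. (arity (es ! i), h [i] (es ! i))) [0..<length es]) xs"
  proof (rule tensor_cong)
    have "map fst (zip (map leaves ?ts) (map composite ?ts)) = map arity es"
      by (rule nth_equalityI) auto
    then show "length xs = sum_list (map fst (zip (map leaves ?ts) (map composite ?ts)))"
      using assms by metis
  qed (auto simp: list_all2_conv_all_nth composite_corolla)
  then show ?thesis
    by simp
qed

lemma vertices_corolla: "vertices (corolla e) = {[]}"
  by (auto simp: corolla_def)

lemma vertices_height_two:
  "vertices (Vertex d (map corolla es)) = insert [] ((\<lambda>i. [i]) ` {..<length es})"
  by (auto simp: vertices_corolla)

text \<open>Only an inclusion, because for \<open>s\<close> beyond the last input the list update
  has no effect. An upper bound on the number of vertices suffices.\<close>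

lemma vertices_graft_subset: "vertices (graft x s y) \<subseteq> {[], [s]}"
proof -
  have "vertices ((replicate (arity x) Leaf)[s := corolla y] ! i) = (if i = s then {[]} else {})"
    if "i < arity x" for i
    using that by (simp add: nth_list_update vertices_corolla)
  then show ?thesis
    by (auto simp: graft_def split: if_splits)
qed

section \<open>Injective placements of cochains on vertices\<close>

lemma finite_injective_tuples: "finite J \<Longrightarrow> finite S \<Longrightarrow> finite (injective_tuples J S)"
  unfolding injective_tuples_def by (rule finite_subset[OF _ finite_PiE]) auto

lemma injective_tuples_empty:
  assumes "finite S" "card S < card J"
  shows "injective_tuples J S = {}"
proof -
  have "card J \<le> card S" if "v \<in> J \<rightarrow>\<^sub>E S" "inj_on v J" for v
    using that assms(1) by (intro card_inj_on_le[of v]) auto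
  then show ?thesis
    using assms(2) unfolding injective_tuples_def by fastforce
qed

text \<open>At most two vertices cannot receive at least three cochains injectively. This disposes
  of every term of the differentials except the trees nu_l(f_{r_1}, ..., f_{r_l}).\<close>

lemma injective_tuples_graft:
  assumes "k \<ge> 3"
  shows "injective_tuples {1..k} (vertices (graft x s y)) = {}"
proof (rule injective_tuples_empty)
  show "finite (vertices (graft x s y))"
    by (rule finite_subset[OF vertices_graft_subset]) simp
  have "card (vertices (graft x s y)) \<le> card {[], [s]}"
    by (rule card_mono[OF _ vertices_graft_subset]) simp
  then show "card (vertices (graft x s y)) < card {1..k}"
    using assms by simp
qed


section \<open>The summands of \<open>l\<^sub>k\<close> at the generators \<open>f\<^sub>m\<close>\<close>

text \<open>The arity \<open>t\<close> is not fixed here: \<open>l_op\<close> is computed at every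
  \<open>F m\<close>, since membership in \<open>cochains\<close> also demands its vanishing at the
  other generators.\<close>

locale cochain_family =
  assoc_algebra_hom sU sV g
  for sU :: "'k::field \<Rightarrow> 'u::ring \<Rightarrow> 'u" and sV :: "'k \<Rightarrow> 'v::ring \<Rightarrow> 'v" and g :: "'u \<Rightarrow> 'v" +
  fixes k :: nat and n :: "nat \<Rightarrow> nat" and \<theta> :: "nat \<Rightarrow> gen \<Rightarrow> ('u \<times> 'v) list \<Rightarrow> 'u \<times> 'v"
  assumes k_ge_3: "k \<ge> 3"
    and n_ge_2: "s \<in> {1..k} \<Longrightarrow> n s \<ge> 2"
    and cochain: "s \<in> {1..k} \<Longrightarrow> \<theta> s \<in> cochains sU sV (n s - 1)"
begin

sublocale T: vector_space_prod sU sV ..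

definition others :: "nat \<Rightarrow> nat set" where
  "others s = {1..k} - {s}"

text \<open>The counterpart of \<^const>\<open>slots\<close> inside \<open>End\<^sub>T\<close>.\<close>

definition slotsT :: "nat \<Rightarrow> (nat \<Rightarrow> nat) \<Rightarrow> (nat \<times> (('u \<times> 'v) list \<Rightarrow> 'u \<times> 'v)) list" where
  "slotsT s a =
     map (\<lambda>q. if q \<in> a ` others s
              then (let j = the_inv_into (others s) a q in (n j - 1, \<theta> j (F (n j - 1))))
              else (1, beta g (F 1))) [1..<n s + 1]"

definition widths :: "nat \<Rightarrow> (nat \<Rightarrow> nat) \<Rightarrow> nat list" where
  "widths s a = map fst (slotsT s a)"

text \<open>The placement belonging to \<open>(s, a)\<close>: \<open>\<theta> s\<close> at the root,
  the others on children. Inputs are counted from 1 but children from 0, hence the shift; the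
  restriction makes the tuple extensional, as \<open>injective_tuples\<close> requires.\<close>

definition vertex_tuple :: "nat \<Rightarrow> (nat \<Rightarrow> nat) \<Rightarrow> nat \<Rightarrow> nat list" where
  "vertex_tuple s a = (\<lambda>j\<in>{1..k}. if j = s then [] else [a j - 1])"

definition nu_tree :: "nat list \<Rightarrow> gen tree" where
  "nu_tree rs = Vertex (Nu (length rs)) (map corolla (map F rs))"

lemma vertices_nu_tree: "vertices (nu_tree rs) = insert [] ((\<lambda>i. [i]) ` {..<length rs})"
  unfolding nu_tree_def vertices_height_two by simp

text \<open>The case distinction is made before the generator is supplied, so that
  \<open>decor v p\<close> as a whole equals some \<open>\<theta> j\<close> or
  \<open>beta g\<close>.\<close>

definition decor :: "(nat \<Rightarrow> nat list) \<Rightarrow> nat list \<Rightarrow> gen \<Rightarrow> ('u \<times> 'v) list \<Rightarrow> 'u \<times> 'v" where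
  "decor v p = (if p \<in> v ` {1..k} then \<theta> (the_inv_into {1..k} v p) else beta g)"

lemma insert_cochains_eq: "insert_cochains (beta g) k \<theta> v \<Gamma> = redecorate \<Gamma> (decor v)"
proof -
  have "decor v = (\<lambda>p e. if p \<in> v ` {1..k} then \<theta> (the_inv_into {1..k} v p) e else beta g e)"
    by (auto simp: decor_def fun_eq_iff)
  then show ?thesis
    by (simp add: insert_cochains_def)
qed

lemma composite_nu_tree:
  assumes "length xs = sum_list rs"
  shows "composite (redecorate (nu_tree rs) h) xs =
    h [] (Nu (length rs)) (tensor (map (\<lambda>i. (rs ! i, h [i] (F (rs ! i)))) [0..<length rs]) xs)"
proof -
  have "map arity (map F rs) = rs"
    by (simp add: map_idI)
  then have *: "length xs = sum_list (map arity (map F rs))"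
    using assms by simp
  have **: "map (\<lambda>i. (arity (map F rs ! i), h [i] (map F rs ! i))) [0..<length (map F rs)] =
      map (\<lambda>i. (rs ! i, h [i] (F (rs ! i)))) [0..<length rs]"
    by simp
  show ?thesis
    unfolding nu_tree_def composite_height_two[OF *] ** ..
qed

section \<open>Supports and multilinearity of the decorations\<close>

lemma theta_multilinear:
  assumes "s \<in> {1..k}"
  shows "\<theta> s \<xi> \<in> multilinear_maps T.scale (part (in_col \<xi>)) (arity \<xi>) (part (out_col \<xi>))"
  using cochain[OF assms] by (simp add: cochains_def)

lemma theta_support:
  assumes "s \<in> {1..k}" "\<theta> s \<xi> \<noteq> (\<lambda>_. 0)"
  shows "is_gen \<xi>" "degree \<xi> + 1 = n s - 1"
  using cochain[OF assms(1)] assms(2) by (auto simp: cochains_def)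

text \<open>The support consists of generators of degree \<open>n s - 2\<close>, and the nu of that
  degree has \<open>n s\<close> inputs.\<close>

lemma theta_Nu_nonzero: "s \<in> {1..k} \<Longrightarrow> \<theta> s (Nu l) \<noteq> (\<lambda>_. 0) \<Longrightarrow> l = n s"
  using theta_support[of s "Nu l"] n_ge_2[of s] by auto

lemma theta_F_nonzero: "s \<in> {1..k} \<Longrightarrow> \<theta> s (F r) \<noteq> (\<lambda>_. 0) \<Longrightarrow> r = n s - 1"
  using theta_support[of s "F r"] n_ge_2[of s] by auto

lemma beta_F_nonzero: "beta g (F r) \<noteq> (\<lambda>_. 0) \<Longrightarrow> r = 1"
  by (auto split: if_splits)

lemma beta_Nu_nonzero: "beta g (Nu l) \<noteq> (\<lambda>_. 0) \<Longrightarrow> l = 2"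
  by (auto split: if_splits)

lemma subspace_part: "T.p.subspace (part c)"
  by (cases c) (auto simp: T.p.subspace_def inU_def inV_def T.scale_def image_iff zero_prod_def)

lemma zero_in_part: "0 \<in> part c"
  by (cases c) (auto simp: inU_def inV_def zero_prod_def image_iff)

lemma beta_F_1_multilinear:
  "beta g (F 1) \<in> multilinear_maps T.scale (part Black) 1 (part White)"
proof -
  have "extend0 (part Black) 1 (\<lambda>xs. inV (g (fst (xs ! 0)))) \<in>
      multilinear_maps T.scale (part Black) 1 (part White)"
    by (rule T.p.extend0_in_multilinear_maps[OF subspace_part zero_in_part])
      (auto simp: inV_def T.scale_def add scale)
  then show ?thesis by simp
qed

lemma finite_others [simp]: "finite (others s)"
  by (simp add: others_def)

lemma card_others: "s \<in> {1..k} \<Longrightarrow> card (others s) = k - 1"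
  by (simp add: others_def)

lemma length_slotsT [simp]: "length (slotsT s a) = n s"
  by (simp add: slotsT_def)

lemma length_widths [simp]: "length (widths s a) = n s"
  by (simp add: widths_def)

lemma nth_slotsT_occupied:
  assumes "inj_on a (others s)" "j \<in> others s" "a j = i + 1" "i < n s"
  shows "slotsT s a ! i = (n j - 1, \<theta> j (F (n j - 1)))"
  using assms the_inv_into_f_f[OF assms(1,2)] imageI[OF assms(2), of a]
  by (simp add: slotsT_def del: upt_Suc)

lemma nth_slotsT_free:
  assumes "i + 1 \<notin> a ` others s" "i < n s"
  shows "slotsT s a ! i = (1, beta g (F 1))"
  using assms by (simp add: slotsT_def del: upt_Suc)

text \<open>The bound on \<open>m\<close> comes from \<open>n j \<ge> 2\<close>; it makes the widths
  positive, as the index set in \<open>bdry (F m)\<close> demands.\<close>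

lemma slotsT_multilinear:
  assumes a: "inj_on a (others s)" and m: "(m, \<psi>) \<in> set (slotsT s a)"
  shows "\<psi> \<in> multilinear_maps T.scale (part Black) m (part White)" "m \<ge> 1"
proof -
  obtain i where i: "i < n s" "slotsT s a ! i = (m, \<psi>)"
    using m by (auto simp: in_set_conv_nth)
  have "\<psi> \<in> multilinear_maps T.scale (part Black) m (part White) \<and> m \<ge> 1"
  proof (cases "i + 1 \<in> a ` others s")
    case True
    then obtain j where j: "j \<in> others s" "a j = i + 1"
      by force
    then have "j \<in> {1..k}"
      by (simp add: others_def)
    moreover have "m = n j - 1" "\<psi> = \<theta> j (F (n j - 1))"
      using i nth_slotsT_occupied[OF a j] by auto
    ultimately show ?thesis
      using theta_multilinear[of j "F (n j - 1)"] n_ge_2[of j] by simp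
  next
    case False
    then show ?thesis
      using i nth_slotsT_free[of i a s] beta_F_1_multilinear by (auto simp del: beta.simps part.simps)
  qed
  then show "\<psi> \<in> multilinear_maps T.scale (part Black) m (part White)" "m \<ge> 1"
    by auto
qed

lemma widths_ge_1: "inj_on a (others s) \<Longrightarrow> r \<in> set (widths s a) \<Longrightarrow> r \<ge> 1"
  using slotsT_multilinear(2) by (fastforce simp: widths_def)

text \<open>The \<open>k - 1\<close> occupied inputs use \<open>n j - 1\<close> arguments each, the
  \<open>n s - (k - 1)\<close> free ones use 1. The total is thus the same for all \<open>s\<close>
  and \<open>a\<close>. It is stated additively to avoid truncated subtraction.\<close>

lemma sum_list_widths:
  assumes s: "s \<in> {1..k}" and a: "a \<in> injective_tuples (others s) {1..n s}"
  shows "sum_list (widths s a) + 2 * (k - 1) = (\<Sum>j\<in>{1..k}. n j)"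
proof -
  have inj: "inj_on a (others s)" and sub: "a ` others s \<subseteq> {1..n s}"
    using a by (auto simp: injective_tuples_def)
  define w where "w q = (if q \<in> a ` others s then n (the_inv_into (others s) a q) - 1 else 1)" for q
  have "widths s a = map w [1..<n s + 1]"
    by (simp add: widths_def slotsT_def w_def Let_def del: upt_Suc)
  then have "sum_list (widths s a) = sum w (set [1..<n s + 1])"
    by (simp add: sum_list_distinct_conv_sum_set del: upt_Suc)
  also have "set [1..<n s + 1] = {1..n s}"
    by auto
  also have "sum w {1..n s} = sum w ({1..n s} - a ` others s) + sum w (a ` others s)"
    by (rule sum.subset_diff[OF sub]) simp
  also have "sum w ({1..n s} - a ` others s) = card ({1..n s} - a ` others s)"
    by (simp add: w_def)
  also have "\<dots> = n s - (k - 1)"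
    using sub by (simp add: card_Diff_subset card_image[OF inj] card_others[OF s])
  also have "sum w (a ` others s) = (\<Sum>j\<in>others s. n j - 1)"
    by (simp add: sum.reindex[OF inj] w_def the_inv_into_f_f[OF inj])
  finally have eq: "sum_list (widths s a) = n s - (k - 1) + (\<Sum>j\<in>others s. n j - 1)" .
  \<comment> \<open>Injectivity of \<open>a\<close> makes \<open>n s - (k - 1)\<close> a true
    difference.\<close>
  have "card (a ` others s) \<le> card {1..n s}"
    by (rule card_mono[OF _ sub]) simp
  then have le: "k - 1 \<le> n s"
    by (simp add: card_image[OF inj] card_others[OF s])
  have "(\<Sum>j\<in>others s. n j) = (\<Sum>j\<in>others s. (n j - 1) + 1)"
    using n_ge_2 by (intro sum.cong) (force simp: others_def)+
  also have "\<dots> = (\<Sum>j\<in>others s. n j - 1) + (k - 1)"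
    by (simp only: sum.distrib sum_constant card_others[OF s]) simp
  finally have "(\<Sum>j\<in>others s. n j) = (\<Sum>j\<in>others s. n j - 1) + (k - 1)" .
  moreover have "(\<Sum>j\<in>{1..k}. n j) = n s + (\<Sum>j\<in>others s. n j)"
    using s by (simp add: others_def sum.remove)
  ultimately show ?thesis
    using eq le by simp
qed

section \<open>Contributing placements and the pairs (s, a)\<close>

lemma vertex_tuple_inj:
  assumes "s \<in> {1..k}" "a \<in> injective_tuples (others s) {1..n s}"
  shows "vertex_tuple s a \<in> injective_tuples {1..k} (vertices (nu_tree (widths s a)))"
proof -
  have a: "inj_on a (others s)" "\<And>j. j \<in> others s \<Longrightarrow> 1 \<le> a j \<and> a j \<le> n s"
    using assms(2) by (auto simp: injective_tuples_def)
  have "vertex_tuple s a j \<in> vertices (nu_tree (widths s a))" if "j \<in> {1..k}" for j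
    using that a(2)[of j] by (auto simp: vertex_tuple_def vertices_nu_tree others_def)
  moreover have "inj_on (vertex_tuple s a) {1..k}"
  proof (rule inj_onI)
    fix i j assume ij: "i \<in> {1..k}" "j \<in> {1..k}" "vertex_tuple s a i = vertex_tuple s a j"
    show "i = j"
    proof (cases "i = s \<or> j = s")
      case True
      then show ?thesis
        using ij by (auto simp: vertex_tuple_def split: if_splits)
    next
      case False
      then have "i \<in> others s" "j \<in> others s"
        using ij by (auto simp: others_def)
      moreover have "a i - 1 = a j - 1"
        using ij False by (auto simp: vertex_tuple_def)
      \<comment> \<open>Subtracting 1 is injective here, because \<open>a\<close> takes values at
        least 1 on \<open>others s\<close>.\<close>
      ultimately have "a i = a j"
        using a(2)[of i] a(2)[of j] by linarith
      then show ?thesis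
        using a(1) \<open>i \<in> others s\<close> \<open>j \<in> others s\<close> by (auto dest: inj_onD)
    qed
  qed
  ultimately show ?thesis
    by (auto simp: injective_tuples_def vertex_tuple_def)
qed

lemma decor_eq_theta: "inj_on v {1..k} \<Longrightarrow> j \<in> {1..k} \<Longrightarrow> v j = p \<Longrightarrow> decor v p = \<theta> j"
  using the_inv_into_f_f[of v "{1..k}" j] by (auto simp: decor_def)

lemma decor_eq_beta: "p \<notin> v ` {1..k} \<Longrightarrow> decor v p = beta g"
  by (simp add: decor_def)

text \<open>Child \<open>i\<close> is either the place of a unique \<open>\<theta> j\<close> with
  \<open>a j = i + 1\<close> or left to \<open>beta g\<close>; in both cases its width and
  decoration form entry \<open>i\<close> of \<open>slotsT s a\<close>.\<close>

lemma composite_vertex_tuple: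
  assumes s: "s \<in> {1..k}" and a: "a \<in> injective_tuples (others s) {1..n s}"
    and xs: "length xs = sum_list (widths s a)"
  shows "composite (redecorate (nu_tree (widths s a)) (decor (vertex_tuple s a))) xs =
    \<theta> s (Nu (n s)) (tensor (slotsT s a) xs)"
proof -
  let ?v = "vertex_tuple s a" and ?rs = "widths s a"
  have inj: "inj_on ?v {1..k}"
    using vertex_tuple_inj[OF s a] by (simp add: injective_tuples_def)
  have a': "inj_on a (others s)" "\<And>j. j \<in> others s \<Longrightarrow> 1 \<le> a j \<and> a j \<le> n s"
    using a by (auto simp: injective_tuples_def)
  have "(?rs ! i, decor ?v [i] (F (?rs ! i))) = slotsT s a ! i" if i: "i < n s" for i
  proof (cases "i + 1 \<in> a ` others s")
    case True
    then obtain j where j: "j \<in> others s" "a j = i + 1"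
      by force
    then have jk: "j \<in> {1..k}" "?v j = [i]"
      by (auto simp: others_def vertex_tuple_def)
    show ?thesis
      using i nth_slotsT_occupied[OF a'(1) j i] decor_eq_theta[OF inj jk] by (simp add: widths_def)
  next
    case False
    have "[i] \<notin> ?v ` {1..k}"
    proof
      assume "[i] \<in> ?v ` {1..k}"
      then obtain j where j: "j \<in> {1..k}" "j \<noteq> s" "a j - 1 = i"
        by (auto simp: vertex_tuple_def split: if_splits)
      then have "j \<in> others s"
        by (simp add: others_def)
      moreover have "a j = i + 1"
        using a'(2)[OF calculation] j by linarith
      ultimately show False
        using False by force
    qed
    then show ?thesis
      using i nth_slotsT_free[OF False i] by (simp add: widths_def decor_eq_beta del: beta.simps)
  qed
  then have "map (\<lambda>i. (?rs ! i, decor ?v [i] (F (?rs ! i)))) [0..<length ?rs] = slotsT s a"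
    by (intro nth_equalityI) auto
  moreover have "decor ?v [] = \<theta> s"
    by (rule decor_eq_theta[OF inj s]) (use s in \<open>simp add: vertex_tuple_def\<close>)
  ultimately show ?thesis
    by (simp add: composite_nu_tree[OF xs])
qed

text \<open>The converse direction. A nonzero value forces the root decoration and, by its
  multilinearity, those of all children to be nonzero; then the supports of the cochains and of
  \<open>beta g\<close> fix all arities.\<close>

lemma composite_nonzero:
  assumes v: "v \<in> injective_tuples {1..k} (vertices (nu_tree rs))"
    and xs: "length xs = sum_list rs"
    and nz: "composite (redecorate (nu_tree rs) (decor v)) xs \<noteq> 0"
  obtains s a where "s \<in> {1..k}" "a \<in> injective_tuples (others s) {1..n s}"
    "rs = widths s a" "v = vertex_tuple s a"
proof -
  let ?\<psi>s = "map (\<lambda>i. (rs ! i, decor v [i] (F (rs ! i)))) [0..<length rs]"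
  have inj: "inj_on v {1..k}" and vv: "\<And>j. j \<in> {1..k} \<Longrightarrow> v j \<in> vertices (nu_tree rs)"
    and ext: "v \<in> extensional {1..k}"
    using v by (auto simp: injective_tuples_def PiE_def)
  have nz': "decor v [] (Nu (length rs)) (tensor ?\<psi>s xs) \<noteq> 0"
    using nz by (simp add: composite_nu_tree[OF xs])
  then have root: "decor v [] (Nu (length rs)) \<noteq> (\<lambda>_. 0)"
    by (auto simp: fun_eq_iff)
  have "[] \<in> v ` {1..k}"
  proof (rule ccontr)
    assume notin: "[] \<notin> v ` {1..k}"
    \<comment> \<open>A root decorated by \<open>beta g\<close> must be the binary nu, which leaves
      only two children for \<open>k \<ge> 3\<close> cochains.\<close>
    then have "length rs = 2"
      using root beta_Nu_nonzero by (simp add: decor_eq_beta del: beta.simps)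
    then have "v ` {1..k} \<subseteq> insert [] ((\<lambda>i. [i]) ` {..<2})"
      using vv by (simp add: vertices_nu_tree image_subset_iff)
    then have "v ` {1..k} \<subseteq> (\<lambda>i. [i]) ` {..<2}"
      using notin by (simp add: subset_insert)
    then have "card (v ` {1..k}) \<le> card ((\<lambda>i. [i]) ` {..<2::nat})"
      by (intro card_mono) auto
    also have "\<dots> \<le> 2"
      using card_image_le[of "{..<2::nat}" "\<lambda>i. [i]"] by simp
    finally show False
      using card_image[OF inj] k_ge_3 by simp
  qed
  then obtain s where s: "s \<in> {1..k}" "v s = []"
    by auto
  have root': "decor v [] = \<theta> s"
    by (rule decor_eq_theta[OF inj s])
  have l: "length rs = n s"
    using theta_Nu_nonzero[OF s(1)] root root' by simp
  have children: "decor v [i] (F (rs ! i)) \<noteq> (\<lambda>_. 0)" if "i < length rs" for i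
  proof
    \<comment> \<open>A zero child puts a 0 among the arguments of the multilinear map at the
      root.\<close>
    assume z: "decor v [i] (F (rs ! i)) = (\<lambda>_. 0)"
    have "(rs ! i, \<lambda>_. 0) \<in> set ?\<psi>s"
      using that z by (force simp: image_iff)
    then have "0 \<in> set (tensor ?\<psi>s xs)"
      by (rule zero_in_tensor)
    then show False
      using nz' T.p.multilinear_maps_zero_entry[OF theta_multilinear[OF s(1)]] by (simp add: root')
  qed
  \<comment> \<open>The path \<open>v j\<close> to a child has a single entry \<open>i\<close>, and
    its input number is \<open>i + 1\<close>. Restriction to \<open>others s\<close> gives the
    extensionality required of \<open>a\<close>.\<close>
  define a where "a = (\<lambda>j\<in>others s. hd (v j) + 1)"
  have va: "v j = [a j - 1] \<and> 1 \<le> a j \<and> a j \<le> n s" if "j \<in> others s" for j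
  proof -
    have "j \<in> {1..k}" "j \<noteq> s"
      using that by (auto simp: others_def)
    \<comment> \<open>Injectivity keeps every other cochain off the root, which
      \<open>\<theta> s\<close> occupies.\<close>
    then have "v j \<noteq> []"
      using inj s by (metis inj_onD)
    then show ?thesis
      using vv[OF \<open>j \<in> {1..k}\<close>] that by (auto simp: vertices_nu_tree a_def l)
  qed
  have a_inj: "inj_on a (others s)"
  proof (rule inj_onI)
    fix i j assume ij: "i \<in> others s" "j \<in> others s" "a i = a j"
    then have "v i = v j"
      using va by metis
    then show "i = j"
      using inj ij by (auto simp: others_def dest: inj_onD)
  qed
  have a: "a \<in> injective_tuples (others s) {1..n s}"
    using a_inj va by (auto simp: injective_tuples_def a_def)
  have "v = vertex_tuple s a"
  proof (rule extensionalityI[OF ext])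
    show "v j = vertex_tuple s a j" if "j \<in> {1..k}" for j
      using that s va[of j] by (auto simp: vertex_tuple_def others_def)
  qed (simp add: vertex_tuple_def)
  moreover have "rs = widths s a"
  proof (rule nth_equalityI)
    fix i assume i: "i < length rs"
    show "rs ! i = widths s a ! i"
    proof (cases "i + 1 \<in> a ` others s")
      case True
      then obtain j where j: "j \<in> others s" "a j = i + 1"
        by force
      then have jk: "j \<in> {1..k}" "v j = [i]"
        using va[of j] by (auto simp: others_def)
      have "rs ! i = n j - 1"
        using children[OF i] theta_F_nonzero[OF jk(1)] decor_eq_theta[OF inj jk] by simp
      then show ?thesis
        using i nth_slotsT_occupied[OF a_inj j] by (simp add: widths_def l)
    next
      case False
      have "[i] \<noteq> v j" if "j \<in> {1..k}" for j
      proof (cases "j = s")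
        case False
        then have "j \<in> others s"
          using that by (simp add: others_def)
        then show ?thesis
          using va[of j] \<open>i + 1 \<notin> a ` others s\<close> by force
      qed (use s in simp)
      then have "decor v [i] = beta g"
        by (intro decor_eq_beta) blast
      \<comment> \<open>Among the f's, \<open>beta g\<close> is nonzero at most at
        \<open>F 1\<close>, hence a free child has width 1.\<close>
      then have "rs ! i = 1"
        using children[OF i] beta_F_nonzero by metis
      then show ?thesis
        using i nth_slotsT_free[OF False] by (simp add: widths_def l del: beta.simps)
    qed
  qed (simp add: l)
  ultimately show thesis
    using that s(1) a by blast
qed

end


section \<open>Summation over all placements\<close>

lemma inV_sum: "inV (\<Sum>i\<in>I. f i) = (\<Sum>i\<in>I. inV (f i) :: 'u::ab_group_add \<times> 'v::ab_group_add)"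
proof -
  have add: "inV (x + y) = (inV x + inV y :: 'u \<times> 'v)" for x y
    by (simp add: inV_def)
  have zero: "inV 0 = (0 :: 'u \<times> 'v)"
    by (simp add: inV_def zero_prod_def)
  show ?thesis
    by (induction I rule: infinite_finite_induct) (simp_all add: add zero)
qed

text \<open>Only the recorded numbers of inputs enter the exponent, so \<open>g\<close> and
  \<open>\<psi>\<close> are arbitrary.\<close>

lemma comp_exp_eq_slots: "comp_exp J n N a = sign_exp (map fst (slots g J n \<psi> N a))"
  by (simp add: comp_exp_def slots_def Let_def comp_def if_distrib[of fst] del: upt_Suc cong: if_cong)

context cochain_family
begin

text \<open>The inner sum of \<open>l_op\<close> as a function of one tree; this is what gets
  extended linearly to \<open>bdry \<xi>\<close>.\<close>

definition tree_sum :: "('u \<times> 'v) list \<Rightarrow> gen tree \<Rightarrow> 'u \<times> 'v" where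
  "tree_sum xs \<Gamma> =
     (\<Sum>v\<in>injective_tuples {1..k} (vertices \<Gamma>). composite (redecorate \<Gamma> (decor v)) xs)"

lemma l_op_eq_lin_ext:
  "l_op sU sV g k p \<theta> \<xi> = extend0 (part (in_col \<xi>)) (arity \<xi>)
     (\<lambda>xs. T.scale ((-1) ^ nu_exp k p) (lin_ext T.scale (tree_sum xs) (bdry \<xi>)))"
  by (simp add: l_op_def lin_ext_def tree_sum_def insert_cochains_eq)

lemma tree_sum_graft: "tree_sum xs (graft x s y) = 0"
  by (simp only: tree_sum_def injective_tuples_graft[OF k_ge_3] sum.empty)

lemma l_op_Mu: "l_op sU sV g k p \<theta> (Mu m) = (\<lambda>_. 0)"
  by (simp add: l_op_eq_lin_ext T.p.lin_ext_sum T.p.lin_ext_single split_beta tree_sum_graft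
      extend0_def fun_eq_iff)

lemma l_op_Nu: "l_op sU sV g k p \<theta> (Nu m) = (\<lambda>_. 0)"
  by (simp add: l_op_eq_lin_ext T.p.lin_ext_sum T.p.lin_ext_single split_beta tree_sum_graft
      extend0_def fun_eq_iff)

definition compositions :: "nat \<Rightarrow> nat \<Rightarrow> nat list set" where
  "compositions m l = {rs. length rs = l \<and> sum_list rs = m \<and> (\<forall>r\<in>set rs. r \<ge> 1)}"

lemma finite_compositions: "finite (compositions m l)"
proof (rule finite_subset)
  show "compositions m l \<subseteq> {rs. set rs \<subseteq> {..m} \<and> length rs = l}"
    by (auto simp: compositions_def intro: member_le_sum_list)
qed (simp add: finite_lists_length_eq)

text \<open>The contribution of \<open>(s, a)\<close> with its sign from the differential; the
  global minus in \<open>bdry (F m)\<close> and the sign from \<open>nu_exp\<close> are kept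
  outside.\<close>

definition summand :: "('u \<times> 'v) list \<Rightarrow> nat \<Rightarrow> (nat \<Rightarrow> nat) \<Rightarrow> 'u \<times> 'v" where
  "summand xs s a =
     T.scale ((-1) ^ sign_exp (widths s a)) (\<theta> s (Nu (n s)) (tensor (slotsT s a) xs))"

text \<open>\<open>s\<close> is recovered as the index sent to the root, and \<open>a\<close> from
  the children.\<close>

lemma vertex_tuple_determines:
  assumes "s \<in> {1..k}" "a \<in> injective_tuples (others s) {1..n s}"
    "s' \<in> {1..k}" "a' \<in> injective_tuples (others s') {1..n s'}"
    "vertex_tuple s a = vertex_tuple s' a'"
  shows "s = s' \<and> a = a'"
proof -
  have "vertex_tuple s' a' s = []"
    by (subst assms(5)[symmetric]) (use assms(1) in \<open>simp add: vertex_tuple_def\<close>)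
  then have s: "s' = s"
    by (rule contrapos_pp) (use assms(1) in \<open>simp add: vertex_tuple_def\<close>)
  have aa': "a \<in> others s \<rightarrow>\<^sub>E {1..n s}" "a' \<in> others s \<rightarrow>\<^sub>E {1..n s}"
    using assms by (auto simp: injective_tuples_def s)
  have "a = a'"
  proof (rule PiE_ext[OF aa'])
    fix j assume j: "j \<in> others s"
    have "vertex_tuple s a j = vertex_tuple s a' j"
      using assms(5) by (simp add: s)
    then have "a j - 1 = a' j - 1"
      using j by (auto simp: vertex_tuple_def others_def)
    moreover have "a j \<ge> 1" "a' j \<ge> 1"
      using PiE_mem[OF aa'(1) j] PiE_mem[OF aa'(2) j] by auto
    ultimately show "a j = a' j"
      by linarith
  qed
  then show ?thesis
    using s by simp
qed

text \<open>Placements on trees are compared with pairs \<open>(s, a)\<close>: the pairs embed, and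
  nothing off the image contributes. The conditional discards pairs whose widths do not add up to
  \<open>m\<close>.\<close>

lemma lin_ext_bdry_F:
  assumes xs: "length xs = m"
  shows "lin_ext T.scale (tree_sum xs) (bdry (F m)) =
    - (\<Sum>s=1..k. \<Sum>a\<in>injective_tuples (others s) {1..n s}.
        if sum_list (widths s a) = m then summand xs s a else 0)"
proof -
  let ?V = "\<lambda>rs. injective_tuples {1..k} (vertices (nu_tree rs))"
  define val where "val = (\<lambda>(l::nat, rs, v).
    T.scale ((-1) ^ sign_exp rs) (composite (redecorate (nu_tree rs) (decor v)) xs))"
  \<comment> \<open>\<open>S\<close> indexes the placements by number of children, widths and tuple,
    \<open>P\<close> the pairs of matching total width; \<open>\<iota>\<close> embeds
    \<open>P\<close> into \<open>S\<close>.\<close>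
  define S where "S = (SIGMA l:{2..m}. SIGMA rs:compositions m l. ?V rs)"
  define Q where "Q = (SIGMA s:{1..k}. injective_tuples (others s) {1..n s})"
  define P where "P = {sa \<in> Q. sum_list (widths (fst sa) (snd sa)) = m}"
  define \<iota> where "\<iota> = (\<lambda>(s, a). (n s, widths s a, vertex_tuple s a))"
  have finV: "finite (?V rs)" for rs
    by (intro finite_injective_tuples) (simp_all add: vertices_nu_tree)
  have finS: "finite S"
    unfolding S_def by (intro finite_SigmaI finite_compositions finV finite_atLeastAtMost)
  have finQ: "finite Q"
    unfolding Q_def by (intro finite_SigmaI finite_injective_tuples) auto
  have P: "s \<in> {1..k}" "a \<in> injective_tuples (others s) {1..n s}" "sum_list (widths s a) = m"
    if "(s, a) \<in> P" for s a
    using that by (auto simp: P_def Q_def)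

  have sub: "\<iota> ` P \<subseteq> S"
  proof (rule image_subsetI)
    fix x assume "x \<in> P"
    moreover obtain s a where x: "x = (s, a)"
      by fastforce
    ultimately have sa: "s \<in> {1..k}" "a \<in> injective_tuples (others s) {1..n s}"
      "sum_list (widths s a) = m"
      using P by blast+
    have ge: "r \<ge> 1" if "r \<in> set (widths s a)" for r
      using widths_ge_1[OF _ that] sa(2) by (simp add: injective_tuples_def)
    \<comment> \<open>All \<open>n s\<close> widths are at least 1, which bounds \<open>n s\<close>
      by \<open>m\<close>, as the range of \<open>l\<close> demands.\<close>
    have "n s = (\<Sum>r\<leftarrow>widths s a. 1)"
      by (simp add: sum_list_triv)
    also have "\<dots> \<le> sum_list (map (\<lambda>r. r) (widths s a))"
      by (rule sum_list_mono) (rule ge)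
    finally have "n s \<le> m"
      using sa(3) by simp
    moreover have "widths s a \<in> compositions m (n s)"
      using sa(3) ge by (simp add: compositions_def)
    ultimately show "\<iota> x \<in> S"
      using n_ge_2[OF sa(1)] vertex_tuple_inj[OF sa(1,2)] by (simp add: S_def \<iota>_def x)
  qed
  have zero: "val x = 0" if x: "x \<in> S - \<iota> ` P" for x
  proof (rule ccontr)
    obtain l rs v where lrv: "x = (l, rs, v)"
      by (cases x)
    assume "val x \<noteq> 0"
    then have nz: "composite (redecorate (nu_tree rs) (decor v)) xs \<noteq> 0"
      by (auto simp: val_def lrv)
    have v: "v \<in> ?V rs" and rs: "sum_list rs = m" "length rs = l"
      using x by (auto simp: S_def lrv compositions_def)
    obtain s a where sa: "s \<in> {1..k}" "a \<in> injective_tuples (others s) {1..n s}"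
      "rs = widths s a" "v = vertex_tuple s a"
      using composite_nonzero[OF v _ nz] xs rs(1) by auto
    then have "(s, a) \<in> P" "x = \<iota> (s, a)"
      using rs by (auto simp: P_def Q_def \<iota>_def lrv)
    then show False
      using x by blast
  qed
  have inj: "inj_on \<iota> P"
  proof (rule inj_onI)
    fix x y assume xy: "x \<in> P" "y \<in> P" "\<iota> x = \<iota> y"
    obtain s a s' a' where eq: "x = (s, a)" "y = (s', a')"
      by (metis surj_pair)
    have "vertex_tuple s a = vertex_tuple s' a'"
      using xy(3) by (simp add: \<iota>_def eq)
    then show "x = y"
      using vertex_tuple_determines[OF P(1,2) P(1,2)] xy(1,2) unfolding eq by blast
  qed
  have val: "val (\<iota> (s, a)) = summand xs s a" if "(s, a) \<in> P" for s a
    using P[OF that] composite_vertex_tuple[of s a xs] xs by (simp add: val_def \<iota>_def summand_def)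

  \<comment> \<open>The grafts in the second half of \<open>bdry (F m)\<close> drop out by
    \<open>tree_sum_graft\<close>; the first half supplies the minus sign.\<close>
  have "lin_ext T.scale (tree_sum xs) (bdry (F m)) =
      - (\<Sum>l=2..m. \<Sum>rs\<in>compositions m l. T.scale ((-1) ^ sign_exp rs) (tree_sum xs (nu_tree rs)))"
    by (auto simp: T.p.lin_ext_diff T.p.lin_ext_uminus T.p.lin_ext_sum T.p.lin_ext_single split_beta
        tree_sum_graft compositions_def nu_tree_def comp_def intro!: sum.cong)
  also have "(\<Sum>l=2..m. \<Sum>rs\<in>compositions m l. T.scale ((-1) ^ sign_exp rs) (tree_sum xs (nu_tree rs))) =
      (\<Sum>l=2..m. \<Sum>rs\<in>compositions m l. \<Sum>v\<in>?V rs. val (l, rs, v))"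
    by (simp add: tree_sum_def val_def T.p.scale_sum_right)
  also have "\<dots> = (\<Sum>l=2..m. \<Sum>x\<in>(SIGMA rs:compositions m l. ?V rs). val (l, x))"
    by (rule sum.cong[OF refl], subst sum.Sigma) (simp_all add: finite_compositions finV[simplified])
  also have "\<dots> = sum val S"
    unfolding S_def by (subst sum.Sigma) (auto intro: finite_compositions finV[simplified])
  also have "\<dots> = sum val (\<iota> ` P)"
    by (rule sum.mono_neutral_right) (use finS sub zero in auto)
  also have "\<dots> = (\<Sum>(s, a)\<in>P. summand xs s a)"
    by (auto simp: sum.reindex[OF inj] val intro!: sum.cong)
  \<comment> \<open>Moving the condition on the widths into the summand leaves the Sigma set
    \<open>Q\<close>, over which the sum can be iterated.\<close>
  also have "\<dots> = (\<Sum>(s, a)\<in>Q. if sum_list (widths s a) = m then summand xs s a else 0)"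
    unfolding P_def sum.inter_filter[OF finQ] by (auto intro!: sum.cong)
  also have "\<dots> = (\<Sum>s=1..k. \<Sum>a\<in>injective_tuples (others s) {1..n s}.
      if sum_list (widths s a) = m then summand xs s a else 0)"
    unfolding Q_def by (subst sum.Sigma) (auto intro: finite_injective_tuples)
  finally show ?thesis .
qed

text \<open>The extension by 0 is pushed inside the sums, so that each pair contributes a
  multilinear map of its own.\<close>

lemma l_op_F:
  "l_op sU sV g k p \<theta> (F m) = (\<lambda>xs. T.scale (- ((-1) ^ nu_exp k p))
     (\<Sum>s=1..k. \<Sum>a\<in>injective_tuples (others s) {1..n s}.
        extend0 (part Black) m
          (\<lambda>xs. if sum_list (widths s a) = m then summand xs s a else 0) xs))"
proof (rule ext, goal_cases)
  case (1 xs)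
  show ?case
  proof (cases "length xs = m \<and> set xs \<subseteq> part Black")
    case True
    then show ?thesis
      by (simp add: l_op_eq_lin_ext extend0_def lin_ext_bdry_F del: bdry.simps part.simps)
  next
    case False
    then have "extend0 (part Black) m f xs = 0" for f :: "('u \<times> 'v) list \<Rightarrow> 'u \<times> 'v"
      unfolding extend0_def by (simp only: if_False)
    then show ?thesis
      by (simp add: l_op_eq_lin_ext del: bdry.simps part.simps)
  qed
qed

section \<open>Multilinearity of the value at f_m\<close>

lemma summand_multilinear:
  assumes s: "s \<in> {1..k}" and a: "a \<in> injective_tuples (others s) {1..n s}"
    and m: "sum_list (widths s a) = m"
  shows "extend0 (part Black) m (\<lambda>xs. summand xs s a) \<in>
    multilinear_maps T.scale (part Black) m (part White)"
proof -
  have inj: "inj_on a (others s)"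
    using a by (simp add: injective_tuples_def)
  have "extend0 (part Black) m (\<lambda>xs. \<theta> s (Nu (n s)) (tensor (slotsT s a) xs)) \<in>
      multilinear_maps T.scale (part Black) m (part White)"
  proof (rule T.p.multilinear_compose_tensor[OF subspace_part zero_in_part])
    show "\<theta> s (Nu (n s)) \<in> multilinear_maps T.scale (part White) (length (slotsT s a)) (part White)"
      using theta_multilinear[OF s, of "Nu (n s)"] by simp
    show "\<psi> \<in> multilinear_maps T.scale (part Black) m' (part White)" if "(m', \<psi>) \<in> set (slotsT s a)"
      for m' \<psi>
      by (rule slotsT_multilinear(1)[OF inj that])
    show "m = sum_list (map fst (slotsT s a))"
      using m by (simp add: widths_def)
  qed
  from T.p.multilinear_maps_scaled[OF subspace_part subspace_part this, of "(-1) ^ sign_exp (widths s a)"]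
  moreover have "T.scale c (extend0 A m f xs) = extend0 A m (\<lambda>xs. T.scale c (f xs)) xs" for c A f xs
    by (simp add: extend0_def)
  ultimately show ?thesis
    by (simp add: summand_def del: part.simps)
qed

lemma l_op_F_multilinear:
  "l_op sU sV g k p \<theta> (F m) \<in> multilinear_maps T.scale (part Black) m (part White)"
proof -
  have "extend0 (part Black) m (\<lambda>xs. if sum_list (widths s a) = m then summand xs s a else 0) \<in>
      multilinear_maps T.scale (part Black) m (part White)"
    if "s \<in> {1..k}" "a \<in> injective_tuples (others s) {1..n s}" for s a
  proof (cases "sum_list (widths s a) = m")
    case True
    then show ?thesis
      using summand_multilinear[OF that True] by (simp del: part.simps)
  next
    case False
    then have "extend0 (part Black) m (\<lambda>xs. if sum_list (widths s a) = m then summand xs s a else 0) =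
        (\<lambda>_. 0)"
      by (simp add: extend0_def fun_eq_iff)
    then show ?thesis
      using zero_in_multilinear_maps[OF T.p.module_axioms zero_in_part] by (simp del: part.simps)
  qed
  then show ?thesis
    unfolding l_op_F
    by (intro T.p.multilinear_maps_scaled T.p.multilinear_maps_sum subspace_part)
qed

section \<open>From End_T to maps between U and V\<close>

text \<open>Values lie in the copy of V, so the projection in \<open>compg\<close> loses
  nothing.\<close>

lemma theta_F_inU:
  "j \<in> {1..k} \<Longrightarrow> \<theta> j (F (n j - 1)) (map inU ys) = inV (compg (n j) (\<theta> j) ys)"
  using multilinear_maps_range[OF theta_multilinear[of j "F (n j - 1)"], of "map inU ys"]
  by (auto simp: compg_def inV_def)

lemma theta_Nu_inV:
  "s \<in> {1..k} \<Longrightarrow> \<theta> s (Nu (n s)) (map inV ys) = inV (compV (n s) (\<theta> s) ys)"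
  using multilinear_maps_range[OF theta_multilinear[of s "Nu (n s)"], of "map inV ys"]
  by (auto simp: compV_def inV_def)

lemma widths_eq_slots: "widths s a = map fst (slots g (others s) n \<psi> (n s) a)"
  by (simp add: widths_def slotsT_def slots_def Let_def del: upt_Suc)

text \<open>On lists from U the slots inside End_T agree with those of the generalized comp
  operation up to the embeddings, and the sign exponents agree because the widths do.\<close>

lemma summand_inU:
  assumes s: "s \<in> {1..k}" and a: "a \<in> injective_tuples (others s) {1..n s}"
    and us: "length us = sum_list (widths s a)"
  shows "summand (map inU us) s a = inV (sV ((-1) ^ comp_exp (others s) n (n s) a)
    (gen_comp g (others s) n (compV (n s) (\<theta> s)) (n s) a (\<lambda>j. compg (n j) (\<theta> j)) us))"
proof -
  let ?\<psi> = "\<lambda>j. compg (n j) (\<theta> j)"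
  have inj: "inj_on a (others s)"
    using a by (simp add: injective_tuples_def)
  have "tensor (slotsT s a) (map inU us) = map inV (tensor (slots g (others s) n ?\<psi> (n s) a) us)"
  proof (rule tensor_map)
    have "the_inv_into (others s) a q \<in> {1..k}" if "q \<in> a ` others s" for q
      using the_inv_into_into[OF inj that subset_refl] by (simp add: others_def)
    \<comment> \<open>The length 1 matters: on other lists \<open>extend0\<close> returns 0.\<close>
    moreover have "beta g (F 1) (map inU ys) = inV (g (hd ys))" if "length ys = 1" for ys
      using that by (cases ys) (auto simp: extend0_def inU_def)
    ultimately show "list_all2 (\<lambda>(m, \<psi>) (m', \<psi>'). m = m' \<and>
        (\<forall>ys. length ys = m \<longrightarrow> \<psi> (map inU ys) = inV (\<psi>' ys)))
        (slotsT s a) (slots g (others s) n ?\<psi> (n s) a)"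
      by (auto simp: slotsT_def slots_def list.rel_map Let_def theta_F_inU intro!: list.rel_refl_strong
          simp del: upt_Suc beta.simps One_nat_def)
    show "length us = sum_list (map fst (slotsT s a))"
      using us by (simp add: widths_def)
  qed
  then show ?thesis
    using comp_exp_eq_slots[of "others s" n "n s" a g ?\<psi>]
    by (simp add: summand_def theta_Nu_inV[OF s] gen_comp_def widths_eq_slots[of s a ?\<psi>]
        inV_def T.scale_def)
qed

end

section \<open>Degree count and conclusion\<close>

theorem theorem6p4:
  fixes sU :: "'k::field_char_0 \<Rightarrow> 'u::ring \<Rightarrow> 'u"
    and sV :: "'k \<Rightarrow> 'v::ring \<Rightarrow> 'v"
    and g :: "'u \<Rightarrow> 'v"
    and k t :: nat
    and n :: "nat \<Rightarrow> nat"
    and \<theta> :: "nat \<Rightarrow> gen \<Rightarrow> ('u \<times> 'v) list \<Rightarrow> 'u \<times> 'v"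
  assumes "assoc_algebra_hom sU sV g"
    and "k \<ge> 3"
    and "\<And>s. s \<in> {1..k} \<Longrightarrow> n s \<ge> 2"
    and "\<And>s. s \<in> {1..k} \<Longrightarrow> \<theta> s \<in> cochains sU sV (n s - 1)"
    and "int t = 3 - 2 * int k + (\<Sum>s=1..k. int (n s))"
  shows "l_op sU sV g k (\<lambda>s. n s - 1) \<theta> \<in> cochains sU sV (t - 1) \<and>
    l_op sU sV g k (\<lambda>s. n s - 1) \<theta> (Mu t) = (\<lambda>_. 0) \<and>
    l_op sU sV g k (\<lambda>s. n s - 1) \<theta> (Nu t) = (\<lambda>_. 0) \<and>
    (\<forall>us. length us = t - 1 \<longrightarrow>
      l_op sU sV g k (\<lambda>s. n s - 1) \<theta> (F (t - 1)) (map inU us) =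
      inV (- sV ((-1) ^ nu_exp k (\<lambda>s. n s - 1))
        (\<Sum>s=1..k. \<Sum>a\<in>injective_tuples ({1..k} - {s}) {1..n s}.
          sV ((-1) ^ comp_exp ({1..k} - {s}) n (n s) a)
            (gen_comp g ({1..k} - {s}) n (compV (n s) (\<theta> s)) (n s) a
              (\<lambda>j. compg (n j) (\<theta> j)) us))))"
proof -
  interpret cochain_family sU sV g k n \<theta>
    by (intro cochain_family.intro cochain_family_axioms.intro) (use assms in auto)
  let ?L = "l_op sU sV g k (\<lambda>s. n s - 1) \<theta>"
  \<comment> \<open>From \<open>n s \<ge> 2\<close> one gets \<open>t \<ge> 3\<close>, so that
    \<open>t - 1\<close> is a true difference and \<open>F (t - 1)\<close> a generator.\<close>
  have "2 * int k \<le> (\<Sum>s=1..k. int (n s))"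
    using sum_mono[of "{1..k}" "\<lambda>_. 2" "\<lambda>s. int (n s)"] n_ge_2 by force
  then have t: "t \<ge> 3"
    using assms(5) by simp
  \<comment> \<open>All pairs have the same total width, so each passes the condition at
    \<open>m = t - 1\<close> and none at any other \<open>m\<close>.\<close>
  have widths: "sum_list (widths s a) = t - 1"
    if "s \<in> {1..k}" "a \<in> injective_tuples (others s) {1..n s}" for s a
  proof -
    have "int (sum_list (widths s a) + 2 * (k - 1)) = (\<Sum>s=1..k. int (n s))"
      using sum_list_widths[OF that] by simp
    then show ?thesis
      using assms(5) t k_ge_3 by linarith
  qed
  have F_zero: "?L (F m) = (\<lambda>_. 0)" if "m \<noteq> t - 1" for m
    unfolding l_op_F using that by (simp add: widths extend0_def fun_eq_iff)
  have "?L \<xi> \<in> multilinear_maps T.scale (part (in_col \<xi>)) (arity \<xi>) (part (out_col \<xi>)) \<and>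
      (\<not> (is_gen \<xi> \<and> degree \<xi> + 1 = t - 1) \<longrightarrow> ?L \<xi> = (\<lambda>_. 0))" for \<xi>
  proof (cases \<xi>)
    case (Mu m)
    then show ?thesis
      using zero_in_multilinear_maps[OF T.p.module_axioms zero_in_part]
      by (simp add: l_op_Mu del: part.simps)
  next
    case (Nu m)
    then show ?thesis
      using zero_in_multilinear_maps[OF T.p.module_axioms zero_in_part]
      by (simp add: l_op_Nu del: part.simps)
  next
    case (F m)
    then show ?thesis
      \<comment> \<open>As \<open>t \<ge> 3\<close>, failing to be a generator with degree plus 1
        equal to \<open>t - 1\<close> means \<open>m \<noteq> t - 1\<close>, the case of
        \<open>F_zero\<close>.\<close>
      using l_op_F_multilinear F_zero[of m] t by (auto simp del: part.simps)
  qed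
  then have "?L \<in> cochains sU sV (t - 1)"
    by (simp add: cochains_def)
  moreover have "?L (F (t - 1)) (map inU us) =
      inV (- sV ((-1) ^ nu_exp k (\<lambda>s. n s - 1))
        (\<Sum>s=1..k. \<Sum>a\<in>injective_tuples (others s) {1..n s}.
          sV ((-1) ^ comp_exp (others s) n (n s) a)
            (gen_comp g (others s) n (compV (n s) (\<theta> s)) (n s) a (\<lambda>j. compg (n j) (\<theta> j)) us)))"
    if us: "length us = t - 1" for us
  proof -
    have "?L (F (t - 1)) (map inU us) = T.scale (- ((-1) ^ nu_exp k (\<lambda>s. n s - 1)))
       (\<Sum>s=1..k. \<Sum>a\<in>injective_tuples (others s) {1..n s}. summand (map inU us) s a)"
      unfolding l_op_F using us by (simp add: widths extend0_def image_subset_iff)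
    also have "\<dots> = T.scale (- ((-1) ^ nu_exp k (\<lambda>s. n s - 1)))
       (inV (\<Sum>s=1..k. \<Sum>a\<in>injective_tuples (others s) {1..n s}.
          sV ((-1) ^ comp_exp (others s) n (n s) a)
            (gen_comp g (others s) n (compV (n s) (\<theta> s)) (n s) a (\<lambda>j. compg (n j) (\<theta> j)) us)))"
      by (simp add: inV_sum summand_inU widths us)
    finally show ?thesis
      by (simp add: inV_def T.scale_def)
  qed
  ultimately show ?thesis
    using l_op_Mu l_op_Nu by (simp add: others_def)
qed

end
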